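(* Let $\ell\ge3$ and let $\lambda$ be a partition. Then $\mathcal{S}\lambda$ is the unique smallest partition, with respect to dominance order, in the regularization class $\mathcal{RC}(\lambda)$; moreover it is the unique partition in $\mathcal{RC}(\lambda)$ all of whose boxes are locked.
   Context: Young diagrams in English notation; $(a,b)$ is the box in row $a$, column $b$. The ladder of a position $(a,b)$ ($a,b\ge1$) is the set of positions $(c,d)$ with $c,d\ge1$ and $c+(\ell-1)d=a+(\ell-1)b$ (a finite set); a position on a ladder is above/below another if its row index is smaller/larger. The regularization $\mathcal{R}\lambda$ is obtained by moving every box to the top of its ladder: if $\lambda$ has $k$ boxes on a ladder, $\mathcal{R}\lambda$ occupies exactly the $k$ topmost positions of that ladder. The regularization class is $\mathcal{RC}(\lambda)=\{\mu:\mathcal{R}\mu=\mathcal{R}\lambda\}$. Dominance order: for $\lambda,\mu\vdash n$, $\lambda\le\mu$ iff $\sum_{j\le i}\lambda_j\le\sum_{j\le i}\mu_j$ for all $i$. Locked boxes: the set of locked boxes of $\lambda$ is the smallest set of boxes of $\lambda$ closed under: (I) a box $x=(a,b)\in\lambda$ is locked if ($a=1$ or $(a-1,b)$ is locked) and every position $(c,d)\notin\lambda$ on the ladder of $x$ with $c>a$ satisfies $(c-1,d)\notin\lambda$; (II) if $(a,b)$ is locked then every box $(a,b')$ with $b'<b$ is locked. Other boxes are unlocked. $\mathcal{S}\lambda$ is the set of positions consisting of all locked boxes of $\lambda$ together with, for each ladder containing $k$ unlocked boxes of $\lambda$, the $k$ lowest positions of that ladder not occupied by locked boxes of $\lambda$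 (i.e. all unlocked boxes are moved, in order, as far down their ladders as possible while locked boxes stay put). *)

theory Defs
  imports Main
begin

text \<open>A partition is the list of its parts, so the \<open>i\<close>-th part (counting from 1) is \<open>p ! (i - 1)\<close>.\<close>

definition is_partition :: "nat list \<Rightarrow> bool" where
  "is_partition p \<longleftrightarrow> sorted_wrt (\<ge>) p \<and> 0 \<notin> set p"

text \<open>A box \<open>(a, b)\<close> is in row \<open>a\<close> and column \<open>b\<close>, both counted from 1; rows go downwards.\<close>

definition diagram :: "nat list \<Rightarrow> (nat \<times> nat) set" where
  "diagram p = {(a, b). 1 \<le> a \<and> a \<le> length p \<and> 1 \<le> b \<and> b \<le> p ! (a - 1)}"

text \<open>Both partitions must have the same size. For \<open>i\<close> beyond the length of a list,
  \<open>take i\<close> is the whole list, which matches padding with zero parts.\<close>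

definition dominance_le :: "nat list \<Rightarrow> nat list \<Rightarrow> bool" where
  "dominance_le p q \<longleftrightarrow>
     sum_list p = sum_list q \<and> (\<forall>i. sum_list (take i p) \<le> sum_list (take i q))"

definition positions :: "(nat \<times> nat) set" where
  "positions = {(a, b). 1 \<le> a \<and> 1 \<le> b}"

definition ladder :: "nat \<Rightarrow> nat \<times> nat \<Rightarrow> (nat \<times> nat) set" where
  "ladder l x =
     {(c, d). 1 \<le> c \<and> 1 \<le> d \<and> c + (l - 1) * d = fst x + (l - 1) * snd x}"

text \<open>For \<open>l \<ge> 2\<close>, distinct positions on one ladder lie in distinct rows. Hence, for a subset
  \<open>A\<close> of a ladder, the following are the \<open>k\<close> elements of \<open>A\<close> with the smallest, respectively
  the largest, row indices (all of \<open>A\<close> if it has at most \<open>k\<close> elements).\<close>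

definition topmost :: "nat \<Rightarrow> (nat \<times> nat) set \<Rightarrow> (nat \<times> nat) set" where
  "topmost k A = {x \<in> A. card {y \<in> A. fst y < fst x} < k}"

definition lowest :: "nat \<Rightarrow> (nat \<times> nat) set \<Rightarrow> (nat \<times> nat) set" where
  "lowest k A = {x \<in> A. card {y \<in> A. fst y > fst x} < k}"

definition regularization :: "nat \<Rightarrow> nat list \<Rightarrow> (nat \<times> nat) set" where
  "regularization l p =
     (\<Union>x\<in>positions. topmost (card (ladder l x \<inter> diagram p)) (ladder l x))"

definition reg_class :: "nat \<Rightarrow> nat list \<Rightarrow> nat list set" where
  "reg_class l p = {q. is_partition q \<and> regularization l q = regularization l p}"

inductive_set locked :: "nat \<Rightarrow> nat list \<Rightarrow> (nat \<times> nat) set"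
  for l :: nat and p :: "nat list" where
  type_I:
    "(a, b) \<in> diagram p \<Longrightarrow> a = 1 \<or> (a - 1, b) \<in> locked l p \<Longrightarrow>
     (\<forall>(c, d) \<in> ladder l (a, b). (c, d) \<notin> diagram p \<and> c > a \<longrightarrow> (c - 1, d) \<notin> diagram p) \<Longrightarrow>
     (a, b) \<in> locked l p"
| type_II:
    "(a, b) \<in> locked l p \<Longrightarrow> 1 \<le> b' \<Longrightarrow> b' < b \<Longrightarrow> (a, b') \<in> locked l p"

definition unlocked :: "nat \<Rightarrow> nat list \<Rightarrow> (nat \<times> nat) set" where
  "unlocked l p = diagram p - locked l p"

definition deregularization :: "nat \<Rightarrow> nat list \<Rightarrow> (nat \<times> nat) set" where
  "deregularization l p = locked l p \<union>
     (\<Union>x\<in>positions. lowest (card (ladder l x \<inter> unlocked l p)) (ladder l x - locked l p))"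

end

theory Submission
  imports Defs
begin

text \<open>Put \<open>m = l - 1\<close> and encode a partition by its profile \<open>f d = h d + m * d\<close>, where \<open>h d\<close> is the
  height of column \<open>d + 1\<close>. Column \<open>d + 1\<close> meets the ladder numbered \<open>N = a + m * (b - 1)\<close> iff
  \<open>m * d < N\<close>, and its box there belongs to the partition iff moreover \<open>N \<le> f d\<close>. Hence two partitions have
  the same regularization iff their profiles take every value equally often.

  All boxes are locked iff the profile is tight: \<open>d < b\<close> and \<open>f d < f b\<close> imply \<open>f d + m < f (b + 1)\<close>.
  A tight profile increases strictly after its first ascent, and this forces it to be determined by its
  multiset of values. The locked boxes of \<open>f\<close> form a partition whose profile is given by
  \<open>g d = Min {f i |i. i \<le> d \<and> g (d + 1) \<le> f i + m}\<close>; it is always tight. Counting the values of \<open>f\<close> and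
  \<open>g\<close> below \<open>N\<close> shows that sliding the unlocked boxes down yields again a profile, and a tight one.
  Sliding down decreases in dominance order, so by uniqueness the result lies below every member of the class.\<close>

section \<open>Selecting the first elements by a key\<close>

text \<open>The rank of an element, the number of elements with smaller key, maps \<open>A\<close>
  injectively into \<open>{..<card A}\<close>, hence onto it. So exactly one element has rank
  \<open>k\<close>, and the induction step adds just that one.\<close>

lemma card_first:
  fixes A :: "'a set" and key :: "'a \<Rightarrow> nat"
  assumes "finite A" "inj_on key A" "k \<le> card A"
  shows "card {x \<in> A. card {y \<in> A. key y < key x} < k} = k"
  using assms
proof (induction k)
  case 0
  then show ?case by simp
next
  case (Suc k)
  let ?r = "\<lambda>x. card {y \<in> A. key y < key x}"
  have mono: "?r x < ?r y" if "x \<in> A" "y \<in> A" "key x < key y" for x y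
  proof (rule psubset_card_mono)
    show "{z \<in> A. key z < key x} \<subset> {z \<in> A. key z < key y}"
      using that by (auto simp: psubset_eq set_eq_iff intro: exI[of _ x])
  qed (use Suc.prems in simp)
  have inj: "inj_on ?r A"
  proof (rule inj_onI)
    fix x y assume xy: "x \<in> A" "y \<in> A" "?r x = ?r y"
    then have "\<not> key x < key y" "\<not> key y < key x" using mono[of x y] mono[of y x] by auto
    then have "key x = key y" by simp
    then show "x = y" using Suc.prems(2) xy by (auto dest: inj_onD)
  qed
  have lt: "?r x < card A" if "x \<in> A" for x
    by (rule psubset_card_mono) (use that Suc.prems(1) in auto)
  have "?r ` A \<subseteq> {..<card A}" using lt by auto
  moreover have "card (?r ` A) = card A" using inj by (simp add: card_image)
  ultimately have "?r ` A = {..<card A}" by (metis card_lessThan card_subset_eq finite_lessThan)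
  then obtain x where x: "x \<in> A" "?r x = k" using Suc.prems(3) by (metis (no_types, lifting) Suc_le_eq imageE lessThan_iff)
  have "{x \<in> A. ?r x < Suc k} = insert x {x \<in> A. ?r x < k}"
    using x inj by (auto simp: less_Suc_eq dest: inj_onD[OF inj])
  with x Suc show ?case by simp
qed

section \<open>Profiles, tightness, and uniqueness of a tight profile with given values\<close>

text \<open>In terms of column heights \<open>f d - m * d\<close>, the clauses say that heights are
  nonnegative, weakly decrease to the right, and vanish eventually.\<close>

definition profile :: "nat \<Rightarrow> (nat \<Rightarrow> nat) \<Rightarrow> bool" where
  "profile m f \<longleftrightarrow> (\<forall>d. m * d \<le> f d) \<and> (\<forall>d. f (Suc d) \<le> f d + m) \<and> (\<exists>n. \<forall>d\<ge>n. f d = m * d)"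

definition tight :: "nat \<Rightarrow> (nat \<Rightarrow> nat) \<Rightarrow> bool" where
  "tight m f \<longleftrightarrow> (\<forall>d b. d < b \<longrightarrow> f d < f b \<longrightarrow> f d + m < f (Suc b))"

lemma finite_below:
  fixes f :: "nat \<Rightarrow> nat"
  assumes "0 < m" "\<And>d. m * d \<le> f d"
  shows "finite {d. f d < N}"
proof (rule finite_subset)
  show "{d. f d < N} \<subseteq> {..N}"
  proof
    fix d assume "d \<in> {d. f d < N}"
    moreover have "d \<le> m * d" using assms(1) by (cases m) auto
    ultimately show "d \<in> {..N}" using assms(2)[of d] by (simp only: mem_Collect_eq atMost_iff)
  qed
qed simp

text \<open>An ascent from \<open>j\<close> to \<open>Suc j\<close> gives
  \<open>f j + m < f (Suc (Suc j))\<close>, and a step gains at most \<open>m\<close>, so the next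
  step ascends too. Without an ascent there, \<open>f i < f j\<close> holds already and the
  induction hypothesis supplies one.\<close>

lemma tight_increasing:
  assumes "tight m f" "\<And>d. f (Suc d) \<le> f d + m" "i < j" "f i < f j"
  shows "f j < f (Suc j)"
  using assms(3,4)
proof (induction j)
  case (Suc j)
  show ?case
  proof (cases "f j < f (Suc j)")
    case True
    then have "f j + m < f (Suc (Suc j))" using assms(1) unfolding tight_def by blast
    then show ?thesis using assms(2)[of j] by simp
  next
    case False
    then have "f i < f j" using Suc.prems by simp
    moreover from this Suc.prems have "i < j" using less_antisym by fastforce
    ultimately show ?thesis using Suc.IH False by simp
  qed
qed simp

lemma tight_strict:
  assumes "tight m f" "\<And>d. f (Suc d) \<le> f d + m" "i < j" "f i < f j" "j < k"
  shows "f j < f k"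
  using assms(5)
proof (induction k)
  case (Suc k)
  show ?case
  proof (cases "j = k")
    case True
    then show ?thesis using tight_increasing[OF assms(1-4)] by simp
  next
    case False
    with Suc have jk: "j < k" "f j < f k" by auto
    with tight_increasing[OF assms(1,2) jk] show ?thesis by simp
  qed
qed simp

text \<open>With \<open>f j = g i\<close>, position \<open>j\<close> carries the only value \<open>g i\<close>, and from there on \<open>f\<close> increases. Let
  \<open>g\<close> first exceed \<open>g i\<close> at \<open>b\<close>. As \<open>g (b - 1) < g i\<close> is a value of \<open>f\<close> left of \<open>j\<close>, tightness of \<open>f\<close>
  makes \<open>f (j + 1)\<close>, the next value after \<open>g i\<close>, exceed \<open>g (b - 1) + m\<close>, hence also \<open>g b\<close>.\<close>
lemma tight_unique_step:
  assumes m: "0 < m"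
    and f: "profile m f" "tight m f" and g: "profile m g" "tight m g"
    and eq: "\<And>v. card {d. i \<le> d \<and> f d = v} = card {d. i \<le> d \<and> g d = v}"
    and lt: "f i < g i"
  shows False
proof -
  have fs: "\<And>d. f (Suc d) \<le> f d + m" and gs: "\<And>d. g (Suc d) \<le> g d + m"
    and fl: "\<And>d. m * d \<le> f d" and gl: "\<And>d. m * d \<le> g d"
    using f g by (auto simp: profile_def)
  have fin: "finite {d. i \<le> d \<and> f d = v}" "finite {d. i \<le> d \<and> g d = v}" for v
    by (rule finite_subset[OF _ finite_below[OF m fl, of "Suc v"]], auto)
       (rule finite_subset[OF _ finite_below[OF m gl, of "Suc v"]], auto)
  have fg: "\<exists>e\<ge>i. f e = g d" if "i \<le> d" for d
  proof -
    have "card {e. i \<le> e \<and> g e = g d} > 0" using that fin by (auto simp: card_gt_0_iff)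
    then have "card {e. i \<le> e \<and> f e = g d} > 0" using eq by simp
    then show ?thesis by (auto simp: card_gt_0_iff)
  qed
  have gf: "\<exists>e\<ge>i. g e = f d" if "i \<le> d" for d
  proof -
    have "card {e. i \<le> e \<and> f e = f d} > 0" using that fin by (auto simp: card_gt_0_iff)
    then have "card {e. i \<le> e \<and> g e = f d} > 0" using eq by simp
    then show ?thesis by (auto simp: card_gt_0_iff)
  qed
  obtain j where j: "i \<le> j" "f j = g i" using fg by blast
  with lt have ij: "i < j" "f i < f j" by (auto simp: le_less)
  have after: "f j < f k" if "j < k" for k using tight_strict[OF f(2) fs ij that] .
  have uniq_f: "k = j" if "i \<le> k" "f k = g i" for k
  proof (rule ccontr)
    assume "k \<noteq> j"
    then consider "j < k" | "k < j" by linarith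
    then show False
    proof cases
      case 1
      then show ?thesis using after that j by fastforce
    next
      case 2
      have "f i < f k" "i < k" using that lt by (auto simp: le_less)
      from tight_strict[OF f(2) fs this(2,1) 2] show ?thesis using that j by simp
    qed
  qed
  \<comment> \<open>From \<open>i\<close> on, the value \<open>g i\<close> occurs once in
    \<open>f\<close>, hence once in \<open>g\<close>, namely at \<open>i\<close> itself.\<close>
  have "{k. i \<le> k \<and> f k = g i} = {j}" using j uniq_f by blast
  then have "card {k. i \<le> k \<and> g k = g i} = 1" using eq[of "g i"] by simp
  then obtain z where "{k. i \<le> k \<and> g k = g i} = {z}" by (auto simp: card_1_singleton_iff)
  then have z: "i \<le> k \<and> g k = g i \<longleftrightarrow> k = z" for k by (simp add: set_eq_iff)
  have uniq_g: "k = i" if "i \<le> k" "g k = g i" for k using z[of k] z[of i] that by simp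
  \<comment> \<open>The lower bound \<open>m * d\<close> makes \<open>g\<close> unbounded, so it
    exceeds \<open>g i\<close> somewhere to the right.\<close>
  have "g i < g (Suc (i + g i))"
  proof -
    have "Suc (i + g i) \<le> m * Suc (i + g i)" using m by (cases m) auto
    then show ?thesis using gl[of "Suc (i + g i)"] by linarith
  qed
  then have ex: "\<exists>b. i < b \<and> g i < g b" by (intro exI[of _ "Suc (i + g i)"]) auto
  define b where "b = (LEAST b. i < b \<and> g i < g b)"
  have b: "i < b" "g i < g b" using LeastI_ex[OF ex] by (auto simp: b_def)
  have min: "g d \<le> g i" if "i < d" "d < b" for d
    using not_less_Least[of d "\<lambda>b. i < b \<and> g i < g b"] that by (auto simp: b_def)
  obtain c where c: "b = Suc c" "i \<le> c" using b(1) by (cases b) auto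
  \<comment> \<open>If \<open>g\<close> ascended right after \<open>i\<close>, all its later values
    would exceed \<open>g i\<close>, and the smaller value \<open>f i\<close> could not
    occur.\<close>
  have "i \<noteq> c"
  proof
    assume "i = c"
    obtain e where e: "i \<le> e" "g e = f i" using gf by blast
    with lt have "i < e" by (auto simp: le_less)
    with \<open>i = c\<close> c b have "e = b \<or> b < e" by auto
    then have "g i < g e" using b tight_strict[OF g(2) gs b] by fastforce
    with e lt show False by simp
  qed
  with c have ic: "i < c" by simp
  have gc: "g c < g i" using min[of c] uniq_g[of c] ic c by fastforce
  obtain k where k: "i \<le> k" "f k = g c" using fg[OF c(2)] by blast
  have "k < j"
  proof (rule ccontr)
    assume "\<not> k < j"
    then have "k = j \<or> j < k" by auto
    then have "f j \<le> f k" using after[of k] by auto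
    then show False using k gc j by simp
  qed
  moreover have "f k < f j" using k gc j by simp
  ultimately have 1: "f k + m < f (Suc j)" using f(2) unfolding tight_def by blast
  obtain k' where k': "i \<le> k'" "f k' = g b" using fg[of b] b by auto
  \<comment> \<open>Left of \<open>j\<close>, the value \<open>g b\<close> would exceed
    \<open>f i\<close>, so \<open>f j\<close> would be larger still; but
    \<open>f j = g i < g b\<close>.\<close>
  have "j < k'"
  proof (rule ccontr)
    assume "\<not> j < k'"
    then consider "k' = j" | "k' < j" by linarith
    then show False
    proof cases
      case 1
      then show ?thesis using k' j b by simp
    next
      case 2
      have "f i < f k'" "i < k'" using k' b lt by (auto simp: le_less)
      from tight_strict[OF f(2) fs this(2,1) 2] show ?thesis using k' j b by simp
    qed
  qed
  then have "k' = Suc j \<or> Suc j < k'" by auto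
  moreover have "f (Suc j) < f k'" if "Suc j < k'"
    using tight_strict[OF f(2) fs _ _ that, of i] ij after[of "Suc j"] by simp
  ultimately have "f (Suc j) \<le> f k'" by auto
  with 1 k k' gs[of c] c show False by simp
qed

lemma card_eq_value:
  fixes f :: "nat \<Rightarrow> nat"
  assumes "\<And>N. finite {d. f d < N}"
  shows "card {d. f d = v} + card {d. f d < v} = card {d. f d < Suc v}"
proof -
  have "{d. f d < Suc v} = {d. f d = v} \<union> {d. f d < v}" by auto
  moreover have "finite {d. f d = v}" by (rule finite_subset[OF _ assms[of "Suc v"]]) auto
  ultimately show ?thesis using assms by (simp add: card_Un_disjoint disjoint_iff)
qed

text \<open>At the first index \<open>i\<close> where the profiles could differ, the parts before
  \<open>i\<close> agree, so the tails from \<open>i\<close> on have equal multiplicities. Then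
  \<open>tight_unique_step\<close> excludes both strict inequalities.\<close>

lemma tight_unique:
  assumes m: "0 < m"
    and f: "profile m f" "tight m f" and g: "profile m g" "tight m g"
    and eq: "\<And>N. card {d. f d < N} = card {d. g d < N}"
  shows "f = g"
proof
  fix i
  have fl: "\<And>d. m * d \<le> f d" and gl: "\<And>d. m * d \<le> g d"
    using f g by (auto simp: profile_def)
  note fin = finite_below[OF m fl] finite_below[OF m gl]
  show "f i = g i"
  proof (induction i rule: less_induct)
    case (less i)
    have tail: "card {d. i \<le> d \<and> f d = v} = card {d. i \<le> d \<and> g d = v}" for v
    proof -
      have split: "card {d. h d = v} = card {d. d < i \<and> h d = v} + card {d. i \<le> d \<and> h d = v}"
        if "\<And>N. finite {d. h d < N}" for h :: "nat \<Rightarrow> nat"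
      proof -
        have "finite {d. h d = v}" by (rule finite_subset[OF _ that[of "Suc v"]]) auto
        moreover have "{d. h d = v} = {d. d < i \<and> h d = v} \<union> {d. i \<le> d \<and> h d = v}" by auto
        moreover have "{d. d < i \<and> h d = v} \<inter> {d. i \<le> d \<and> h d = v} = {}" by auto
        ultimately show ?thesis by (metis card_Un_disjoint finite_Un)
      qed
      have "{d. d < i \<and> f d = v} = {d. d < i \<and> g d = v}" using less by auto
      moreover have "card {d. f d = v} = card {d. g d = v}"
        using card_eq_value[OF fin(1), of v] card_eq_value[OF fin(2), of v] eq by simp
      ultimately show ?thesis using split[OF fin(1)] split[OF fin(2)] by simp
    qed
    show ?case
    proof (rule ccontr)
      assume "f i \<noteq> g i"
      then consider "f i < g i" | "g i < f i" by linarith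
      then show False
        using tight_unique_step[OF m f g tail] tight_unique_step[OF m g f tail[symmetric]] by cases
    qed
  qed
qed

section \<open>The profile of the locked boxes and the sliding of the unlocked ones\<close>

text \<open>Here \<open>f\<close> belongs to the partition and \<open>g\<close> to its locked boxes.
  \<open>g_value\<close> and \<open>g_step\<close> place \<open>g d\<close> in the set whose minimum
  it should be, and \<open>g_min\<close> is minimality; the sliding argument uses only these
  inequalities.\<close>

locale locked_profile =
  fixes m :: nat and f g :: "nat \<Rightarrow> nat"
  assumes m: "0 < m" and f: "profile m f"
    and g_lower: "m * d \<le> g d" and g_le: "g d \<le> f d" and g_step: "g (Suc d) \<le> g d + m"
    and g_value: "\<exists>i\<le>d. g d = f i"
    and g_min: "i \<le> d \<Longrightarrow> g (Suc d) \<le> f i + m \<Longrightarrow> g d \<le> f i"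
begin

lemma f_lower: "m * d \<le> f d" and f_step: "f (Suc d) \<le> f d + m"
  using f by (auto simp: profile_def)

lemma finite_f: "finite {d. f d < N}" and finite_g: "finite {d. g d < N}"
  using finite_below[OF m f_lower] finite_below[OF m g_lower] by auto

lemma finite_g': "finite {e. P e \<and> g e < N}"
  by (auto intro: finite_subset[OF _ finite_g[of N]])

text \<open>Write \<open>g d = f i\<close> with \<open>i \<le> d\<close>. If
  \<open>g (Suc b)\<close> were at most \<open>f i + m\<close>, minimality would force
  \<open>g b \<le> f i = g d\<close>.\<close>

lemma tight_g: "tight m g"
  unfolding tight_def
proof (intro allI impI, rule ccontr)
  fix d b assume db: "d < b" "g d < g b" and n: "\<not> g d + m < g (Suc b)"
  obtain i where "i \<le> d" "g d = f i" using g_value by blast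
  then show False using g_min[of i b] db n by simp
qed

text \<open>Induction goes leftwards from the empty columns. If \<open>g d = f i < f d\<close>,
  tightness puts \<open>f (Suc d) = g (Suc d)\<close> above \<open>g d + m\<close>, against the step
  bound for \<open>g\<close>.\<close>

lemma tight_imp_eq:
  assumes "tight m f"
  shows "g = f"
proof
  fix d
  obtain n where n: "\<And>d. d \<ge> n \<Longrightarrow> f d = m * d" using f by (auto simp: profile_def)
  show "g d = f d"
  proof (induction "n - d" arbitrary: d)
    case 0
    then show ?case using n g_lower[of d] g_le[of d] by simp
  next
    case (Suc k)
    then have IH: "g (Suc d) = f (Suc d)" by (metis Suc_diff_Suc Suc_inject zero_less_Suc zero_less_diff)
    obtain i where i: "i \<le> d" "g d = f i" using g_value by blast
    show ?case
    proof (rule ccontr)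
      assume "g d \<noteq> f d"
      then have "f i < f d" "i < d" using i g_le[of d] by (auto simp: le_less)
      then have "f i + m < f (Suc d)" using assms unfolding tight_def by blast
      with IH i g_step[of d] show False by simp
    qed
  qed
qed

text \<open>For \<open>m * d < N\<close>, \<open>occ d N\<close> says that column \<open>d + 1\<close> is occupied on ladder \<open>N\<close> after sliding. If
  \<open>g d < N\<close> this means that fewer than \<open>card {e. g e < N \<and> N \<le> f e}\<close> free positions lie below it; as
  \<open>g \<le> f\<close>, passing to complements in \<open>{e. g e < N}\<close> gives the form used here (see \<open>occ_iff_card\<close>).\<close>
definition occ :: "nat \<Rightarrow> nat \<Rightarrow> bool" where
  "occ d N \<longleftrightarrow> N \<le> g d \<or> card {e. f e < N} < card {e. d \<le> e \<and> g e < N}"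

text \<open>To the right of a column that it exceeds, \<open>g\<close> is injective, and its values are values of \<open>f\<close>.\<close>
lemma card_window:
  assumes "g d < A" "A \<le> B"
  shows "card {e. d \<le> e \<and> g e < B} + card {e. f e < A} \<le> card {e. d \<le> e \<and> g e < A} + card {e. f e < B}"
proof -
  let ?X = "{e. d \<le> e \<and> A \<le> g e \<and> g e < B}" and ?Y = "{e. A \<le> f e \<and> f e < B}"
  have fin: "finite ?X" "finite ?Y"
    by (auto intro: finite_subset[OF _ finite_f[of B]] finite_subset[OF _ finite_g[of B]])
  have "inj_on g ?X"
  proof (rule linorder_inj_onI)
    fix x y assume "x < y" "x \<in> ?X" "y \<in> ?X"
    then have "d < x" "g d < g x" using assms by (auto simp: le_less)
    from tight_strict[OF tight_g g_step this \<open>x < y\<close>] show "g x \<noteq> g y" by simp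
  qed (use linear in auto)
  then have "card ?X = card (g ` ?X)" by (simp add: card_image)
  also have "\<dots> \<le> card (f ` ?Y)"
  proof (rule card_mono)
    show "g ` ?X \<subseteq> f ` ?Y"
    proof
      fix v assume "v \<in> g ` ?X"
      then obtain e where e: "A \<le> g e" "g e < B" "v = g e" by auto
      obtain i where "g e = f i" using g_value by blast
      then show "v \<in> f ` ?Y" using e by auto
    qed
  qed (use fin in auto)
  also have "\<dots> \<le> card ?Y" using fin by (simp add: card_image_le)
  finally have "card ?X \<le> card ?Y" .
  moreover have "card {e. d \<le> e \<and> g e < B} = card {e. d \<le> e \<and> g e < A} + card ?X"
    using fin(1) finite_g' assms by (subst card_Un_disjoint[symmetric]) (auto intro: arg_cong[of _ _ card])
  moreover have "card {e. f e < B} = card {e. f e < A} + card ?Y"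
    using fin(2) finite_f assms by (subst card_Un_disjoint[symmetric]) (auto intro: arg_cong[of _ _ card])
  ultimately show ?thesis by simp
qed

text \<open>For \<open>g d < A\<close>, passing from \<open>A\<close> to \<open>B\<close> enlarges
  the count of \<open>g\<close> by at most that of \<open>f\<close>, so strictness at
  \<open>B\<close> gives strictness at \<open>A\<close>. Thus occupied boxes fill each column from
  the top.\<close>

lemma occ_down:
  assumes "occ d B" "A \<le> B"
  shows "occ d A"
proof (cases "A \<le> g d")
  case False
  then show ?thesis using assms card_window[of d A B] by (auto simp: occ_def)
qed (simp add: occ_def)

text \<open>Ladder \<open>N + m\<close> meets the next column in the same row as ladder
  \<open>N\<close> meets this one, so this is closure to the left within a row.\<close>

lemma occ_step:
  assumes "occ (Suc d) (N + m)"
  shows "occ d N"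
proof (cases "N \<le> g d")
  case False
  then have "g (Suc d) < N + m" using g_step[of d] by simp
  with assms have 1: "card {e. f e < N + m} < card {e. Suc d \<le> e \<and> g e < N + m}" by (simp add: occ_def)
  also have "\<dots> \<le> card {e. d \<le> e \<and> g e < N + m}" by (rule card_mono[OF finite_g']) auto
  finally show ?thesis using card_window[of d N "N + m"] False by (simp add: occ_def)
qed (simp add: occ_def)

text \<open>\<open>Suc (m * d)\<close> is the ladder of the top position of column
  \<open>d + 1\<close>, so far to the right the columns stay empty. There \<open>d\<close> alone can
  contribute to the count of \<open>g\<close>, and it contributes to that of \<open>f\<close> as
  well.\<close>

lemma not_occ_eventually: "\<exists>n. \<forall>d\<ge>n. \<not> occ d (Suc (m * d))"
proof -
  obtain n where n: "\<And>d. d \<ge> n \<Longrightarrow> f d = m * d" using f by (auto simp: profile_def)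
  have "\<not> occ d (Suc (m * d))" if "d \<ge> n" for d
  proof -
    have fd: "f d = m * d" using n that by simp
    have "{e. d \<le> e \<and> g e < Suc (m * d)} \<subseteq> {d}"
    proof
      fix e assume "e \<in> {e. d \<le> e \<and> g e < Suc (m * d)}"
      then have "d \<le> e" "g e \<le> m * d" by auto
      moreover from this have "m * e \<le> m * d" using g_lower[of e] by linarith
      ultimately show "e \<in> {d}" using m by (auto simp only: mult_le_cancel1 singleton_iff)
    qed
    then have "card {e. d \<le> e \<and> g e < Suc (m * d)} \<le> card {d}" by (rule card_mono[rotated]) simp
    moreover have "card {e. f e < Suc (m * d)} > 0"
      unfolding card_gt_0_iff using finite_f fd by (auto intro!: exI[of _ d])
    ultimately show ?thesis using g_le[of d] fd by (simp add: occ_def)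
  qed
  then show ?thesis by blast
qed

lemma not_occ_ex: "\<exists>N. \<not> occ d (Suc N)"
proof -
  obtain n where n: "\<And>d. d \<ge> n \<Longrightarrow> f d = m * d" using f by (auto simp: profile_def)
  \<comment> \<open>This bound dominates \<open>g d\<close> and every \<open>f e\<close> with
    \<open>e < n\<close>. For the other \<open>e\<close>, \<open>f e = m * e \<le> g e\<close>, so
    every column counted for \<open>g\<close> is counted for \<open>f\<close>.\<close>
  define N where "N = g d + (\<Sum>e<n. f e)"
  have "{e. d \<le> e \<and> g e < Suc N} \<subseteq> {e. f e < Suc N}"
  proof
    fix e assume e: "e \<in> {e. d \<le> e \<and> g e < Suc N}"
    show "e \<in> {e. f e < Suc N}"
    proof (cases "e < n")
      case True
      then have "f e \<le> (\<Sum>e<n. f e)" by (intro member_le_sum) auto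
      then show ?thesis by (simp add: N_def)
    next
      case False
      then show ?thesis using n[of e] g_lower[of e] e by simp
    qed
  qed
  then have "card {e. d \<le> e \<and> g e < Suc N} \<le> card {e. f e < Suc N}" by (rule card_mono[OF finite_f])
  then have "\<not> occ d (Suc N)" by (simp add: occ_def N_def)
  then show ?thesis by blast
qed

text \<open>Since \<open>occ d 0\<close> holds and \<open>occ_down\<close> gives downward closure,
  this is the largest occupied \<open>N\<close>, hence the profile after sliding.\<close>

definition slid :: "nat \<Rightarrow> nat" where
  "slid d = (LEAST N. \<not> occ d (Suc N))"

lemma occ_iff: "occ d N \<longleftrightarrow> N \<le> slid d"
proof
  assume occ: "occ d N"
  show "N \<le> slid d"
  proof (rule ccontr)
    assume "\<not> N \<le> slid d"
    then have "occ d (Suc (slid d))" using occ_down[OF occ] by simp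
    moreover have "\<not> occ d (Suc (slid d))" unfolding slid_def using not_occ_ex by (rule LeastI_ex)
    ultimately show False by simp
  qed
next
  assume le: "N \<le> slid d"
  have "occ d (slid d)"
  proof (cases "slid d")
    case (Suc k)
    then show ?thesis using not_less_Least[of k "\<lambda>N. \<not> occ d (Suc N)"] by (simp add: slid_def)
  qed (simp add: occ_def)
  then show "occ d N" using occ_down le by blast
qed

lemma g_le_slid: "g d \<le> slid d"
  using occ_iff[of d "g d"] by (simp add: occ_def)

lemma profile_slid: "profile m slid"
  unfolding profile_def
proof (intro conjI allI)
  show lower: "m * d \<le> slid d" for d using g_lower[of d] g_le_slid[of d] by simp
  show "slid (Suc d) \<le> slid d + m" for d
  proof (cases "m \<le> slid (Suc d)")
    case True
    then have "occ (Suc d) ((slid (Suc d) - m) + m)" using occ_iff by simp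
    then have "occ d (slid (Suc d) - m)" by (rule occ_step)
    then show ?thesis using occ_iff by simp
  qed simp
  obtain n where n: "\<And>d. d \<ge> n \<Longrightarrow> \<not> occ d (Suc (m * d))" using not_occ_eventually by blast
  have "slid d = m * d" if "d \<ge> n" for d
    using n[OF that] occ_iff[of d "Suc (m * d)"] lower[of d] by simp
  then show "\<exists>n. \<forall>d\<ge>n. slid d = m * d" by blast
qed

text \<open>Let \<open>N\<close> be the first ladder unoccupied in column \<open>d + 1\<close> but
  occupied in column \<open>b + 1\<close>. Counts shrink to the right, so
  \<open>N \<le> g b\<close>, and tightness of \<open>g\<close> applies to \<open>d\<close> and
  \<open>b\<close>. If its conclusion is too weak, \<open>f\<close> has no value from
  \<open>X\<close> up to \<open>N\<close>, so column \<open>d + 1\<close> was already unoccupied on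
  ladder \<open>X\<close>, which bounds \<open>slid d\<close>.\<close>

lemma tight_slid: "tight m slid"
  unfolding tight_def
proof (intro allI impI)
  fix d b assume db: "d < b" "slid d < slid b"
  define N where "N = Suc (slid d)"
  have N: "\<not> occ d N" "occ b N" using db by (auto simp: occ_iff N_def)
  then have gd: "g d < N" and T: "card {e. d \<le> e \<and> g e < N} \<le> card {e. f e < N}"
    by (auto simp: occ_def)
  have "card {e. b \<le> e \<and> g e < N} \<le> card {e. d \<le> e \<and> g e < N}"
    by (rule card_mono[OF finite_g']) (use db in auto)
  with N T have gb: "N \<le> g b" by (auto simp: occ_def)
  with gd have dgb: "g d < g b" by simp
  with db have gdb: "g d + m < g (Suc b)" using tight_g unfolding tight_def by blast
  define X where "X = g (Suc b) - m"
  show "slid d + m < slid (Suc b)"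
  proof (cases "X \<le> slid d")
    case False
    then show ?thesis using g_le_slid[of "Suc b"] gdb by (simp add: X_def)
  next
    case True
    \<comment> \<open>A value of \<open>f\<close> in the gap contradicts \<open>N \<le> g b\<close>:
      up to \<open>b\<close> by minimality of \<open>g b\<close>, and beyond \<open>b\<close>
      because \<open>g\<close> increases and lies below \<open>f\<close>.\<close>
    have "f e < X" if "f e < N" for e
    proof (rule ccontr)
      assume n: "\<not> f e < X"
      show False
      proof (cases "e \<le> b")
        case True
        then show ?thesis using g_min[of e b] n that gb gdb by (simp add: X_def not_less le_diff_conv)
      next
        case False
        then have "g b < g e" using tight_strict[OF tight_g g_step db(1) dgb] by simp
        then show ?thesis using gb g_le[of e] that by simp
      qed
    qed
    then have "{e. f e < N} = {e. f e < X}" using True by (auto simp: N_def)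
    moreover have "card {e. d \<le> e \<and> g e < X} \<le> card {e. d \<le> e \<and> g e < N}"
      by (rule card_mono[OF finite_g']) (use True in \<open>auto simp: N_def\<close>)
    ultimately have "\<not> occ d X" using T gdb by (simp add: occ_def X_def)
    then have "slid d < X" by (simp add: occ_iff)
    then show ?thesis using g_le_slid[of "Suc b"] by (simp add: X_def)
  qed
qed

lemma card_f_le_g: "card {e. f e < N} \<le> card {e. g e < N}"
  by (rule card_mono[OF finite_g]) (use g_le le_less_trans in blast)

lemma slid_less_iff:
  "slid d < N \<longleftrightarrow> g d < N \<and> card {e. d \<le> e \<and> g e < N} \<le> card {e. f e < N}"
  using occ_iff[of d N] by (auto simp: occ_def)

lemma card_from:
  "card {e. e < d \<and> g e < N} + card {e. d \<le> e \<and> g e < N} = card {e. g e < N}"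
  using finite_g' by (subst card_Un_disjoint[symmetric]) (auto intro: arg_cong[of _ _ card])

lemma occ_iff_card:
  assumes "g d < N"
  shows "occ d N \<longleftrightarrow> card {e. e < d \<and> g e < N} < card {e. g e < N \<and> N \<le> f e}"
proof -
  have "card {e. f e < N} + card {e. g e < N \<and> N \<le> f e} = card {e. g e < N}"
  proof (subst card_Un_disjoint[symmetric])
    show "finite {e. g e < N \<and> N \<le> f e}" by (rule finite_subset[OF _ finite_g[of N]]) auto
    show "card ({e. f e < N} \<union> {e. g e < N \<and> N \<le> f e}) = card {e. g e < N}"
      by (rule arg_cong[of _ _ card]) (use le_less_trans[OF g_le] in auto)
  qed (use finite_f in auto)
  then show ?thesis using card_from[of d N] assms by (auto simp: occ_def)
qed

text \<open>Among the columns with \<open>g d < N\<close>, sliding fills exactly the leftmost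
  \<open>?k\<close>, that is, the lowest free positions of the ladder; as many columns stay empty as
  before.\<close>

lemma card_slid: "card {d. slid d < N} = card {d. f d < N}"
proof -
  let ?A = "{d. g d < N}"
  let ?k = "card ?A - card {d. f d < N}"
  have "card {x \<in> ?A. card {y \<in> ?A. y < x} < ?k} = ?k"
    by (rule card_first[where key = id, simplified]) (use finite_g in auto)
  moreover have "{x \<in> ?A. card {y \<in> ?A. y < x} < ?k} = ?A - {d. slid d < N}"
  proof -
    have "card {y \<in> ?A. y < x} < ?k \<longleftrightarrow> \<not> slid x < N" if "g x < N" for x
    proof -
      have "{y \<in> ?A. y < x} = {y. y < x \<and> g y < N}" by auto
      then show ?thesis using card_from[of x N] slid_less_iff[of x N] that by (simp add: less_diff_conv2 not_le) linarith
    qed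
    then show ?thesis by auto
  qed
  moreover have sub: "{d. slid d < N} \<subseteq> ?A" using slid_less_iff by auto
  moreover have "card (?A - {d. slid d < N}) = card ?A - card {d. slid d < N}"
    using sub finite_g by (intro card_Diff_subset) (auto intro: finite_subset)
  moreover have "card {d. slid d < N} \<le> card ?A" using sub finite_g by (simp add: card_mono)
  ultimately show ?thesis using card_f_le_g[of N] by simp
qed

text \<open>Sliding moves gaps towards the top of a ladder, that is, to the right. Either all free
  columns from \<open>c\<close> on stay empty, and these include the old gaps there, or all new gaps
  lie from \<open>c\<close> on and their total number is unchanged.\<close>

lemma card_slid_from: "card {d. c \<le> d \<and> f d < N} \<le> card {d. c \<le> d \<and> slid d < N}"
proof (cases "card {e. c \<le> e \<and> g e < N} \<le> card {e. f e < N}")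
  case True
  have "{d. c \<le> d \<and> f d < N} \<subseteq> {d. c \<le> d \<and> g d < N}" using g_le le_less_trans by blast
  moreover have "{d. c \<le> d \<and> g d < N} \<subseteq> {d. c \<le> d \<and> slid d < N}"
  proof safe
    fix d assume "c \<le> d" "g d < N"
    moreover from this have "card {e. d \<le> e \<and> g e < N} \<le> card {e. c \<le> e \<and> g e < N}"
      by (intro card_mono[OF finite_g']) auto
    ultimately show "slid d < N" using True by (simp add: slid_less_iff)
  qed
  moreover have "finite {d. c \<le> d \<and> slid d < N}"
    by (rule finite_subset[OF _ finite_g[of N]]) (auto simp: slid_less_iff)
  ultimately show ?thesis by (meson card_mono order_trans)
next
  case False
  have "{d. slid d < N} = {d. c \<le> d \<and> slid d < N}"
  proof safe
    fix d assume d: "slid d < N"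
    show "c \<le> d"
    proof (rule ccontr)
      assume "\<not> c \<le> d"
      then have "card {e. c \<le> e \<and> g e < N} \<le> card {e. d \<le> e \<and> g e < N}"
        by (intro card_mono[OF finite_g']) auto
      with False d show False by (simp add: slid_less_iff)
    qed
  qed
  with card_slid have "card {d. c \<le> d \<and> slid d < N} = card {d. f d < N}" by metis
  moreover have "card {d. c \<le> d \<and> f d < N} \<le> card {d. f d < N}"
    by (rule card_mono[OF finite_f]) auto
  ultimately show ?thesis by simp
qed

end

section \<open>Translation between partitions and profiles\<close>

definition prof :: "nat \<Rightarrow> nat list \<Rightarrow> nat \<Rightarrow> nat" where
  "prof m p d = length (filter (\<lambda>x. d < x) p) + m * d"

text \<open>Columns are counted from 0 here, so \<open>N\<close> is smaller by \<open>m\<close> than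
  the constant in \<open>ladder\<close>. The subtraction yields an actual row only for
  \<open>m * d < N\<close>.\<close>

definition pos :: "nat \<Rightarrow> nat \<Rightarrow> nat \<Rightarrow> nat \<times> nat" where
  "pos m N d = (N - m * d, Suc d)"

text \<open>In a weakly decreasing list the parts exceeding \<open>d\<close> form a prefix, so their
  number is the height of column \<open>d + 1\<close>.\<close>

lemma less_length_filter_iff:
  fixes p :: "nat list"
  assumes "sorted_wrt (\<ge>) p"
  shows "i < length (filter (\<lambda>x. d < x) p) \<longleftrightarrow> i < length p \<and> d < p ! i"
  using assms
proof (induction p arbitrary: i)
  case (Cons x p)
  show ?case
  proof (cases "d < x")
    case True
    then show ?thesis using Cons by (cases i) auto
  next
    case False
    then have le: "\<forall>y\<in>set p. y \<le> d" using Cons.prems by auto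
    then have "filter (\<lambda>x. d < x) p = []" by (auto simp: filter_empty_conv)
    moreover have "(x # p) ! i \<le> d" if "i < Suc (length p)"
      using that le False by (cases i) auto
    ultimately show ?thesis using False by auto
  qed
qed simp

lemma mem_diagram_iff:
  assumes "is_partition p"
  shows "(a, Suc d) \<in> diagram p \<longleftrightarrow> 1 \<le> a \<and> a + m * d \<le> prof m p d"
proof (cases a)
  case (Suc i)
  then show ?thesis using less_length_filter_iff[of p i d] assms
    by (auto simp: diagram_def prof_def is_partition_def Suc_le_eq)
qed (simp add: diagram_def)

lemma pos_mem_diagram_iff:
  assumes "is_partition p" "m * d < N"
  shows "pos m N d \<in> diagram p \<longleftrightarrow> N \<le> prof m p d"
  using mem_diagram_iff[OF assms(1), of "N - m * d" d m] assms(2) by (auto simp: pos_def)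

lemma positions_cases:
  assumes "x \<in> positions"
  obtains N d where "m * d < N" "x = pos m N d"
proof -
  obtain a b where ab: "x = (a, b)" "1 \<le> a" "1 \<le> b" using assms by (auto simp: positions_def)
  show ?thesis by (rule that[of "b - 1" "a + m * (b - 1)"]) (use ab in \<open>auto simp: pos_def\<close>)
qed

lemma pos_mem_positions: "m * d < N \<Longrightarrow> pos m N d \<in> positions"
  by (auto simp: pos_def positions_def)

lemma profile_prof:
  assumes "is_partition p"
  shows "profile m (prof m p)"
  unfolding profile_def
proof (intro conjI allI)
  show "m * d \<le> prof m p d" for d by (simp add: prof_def)
  show "prof m p (Suc d) \<le> prof m p d + m" for d
  proof -
    have "length (filter (\<lambda>x. Suc d < x) p) \<le> length (filter (\<lambda>x. d < x) p)"
      by (induction p) auto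
    then show ?thesis by (simp add: prof_def)
  qed
  have "prof m p d = m * d" if "sum_list p \<le> d" for d
    using that member_le_sum_list[of _ p] by (fastforce simp: prof_def filter_empty_conv)
  then show "\<exists>n. \<forall>d\<ge>n. prof m p d = m * d" by blast
qed

lemma prof_inject:
  assumes "is_partition p" "is_partition q" "prof m p = prof m q"
  shows "p = q"
proof -
  have eq: "length (filter (\<lambda>x. d < x) p) = length (filter (\<lambda>x. d < x) q)" for d
    using fun_cong[OF assms(3), of d] by (simp add: prof_def)
  have pos: "filter (\<lambda>x. 0 < x) r = r" if "is_partition r" for r :: "nat list"
    using that by (auto simp: is_partition_def filter_id_conv intro: gr0I)
  have len: "length p = length q" using eq[of 0] pos assms by simp
  show ?thesis
  proof (rule nth_equalityI[OF len])
    fix i assume i: "i < length p"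
    have "d < p ! i \<longleftrightarrow> d < q ! i" for d
      using less_length_filter_iff[of p i d] less_length_filter_iff[of q i d] eq[of d] i len assms
      by (auto simp: is_partition_def)
    then show "p ! i = q ! i" by (meson less_irrefl linorder_neqE_nat)
  qed
qed

lemma downset_eq_lessThan:
  fixes A :: "nat set"
  assumes "finite A" "\<And>x y. x \<in> A \<Longrightarrow> y < x \<Longrightarrow> y \<in> A"
  shows "A = {..<card A}"
proof (cases "A = {}")
  case False
  have "A = {..Max A}"
  proof
    show "{..Max A} \<subseteq> A" using assms(2)[OF Max_in[OF assms(1) False]] Max_in[OF assms(1) False]
      by (auto simp: le_less)
  qed (use assms(1) in auto)
  then show ?thesis by (metis card_atMost lessThan_Suc_atMost)
qed simp

lemma profile_ex:
  assumes "profile m f"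
  shows "\<exists>q. is_partition q \<and> prof m q = f"
proof -
  define h where "h d = f d - m * d" for d
  have lower: "m * d \<le> f d" for d using assms by (simp add: profile_def)
  have anti: "h e \<le> h d" if "d \<le> e" for d e
    using that
  proof (induction e rule: dec_induct)
    case (step k)
    have "f (Suc k) \<le> f k + m" using assms by (simp add: profile_def)
    with step show ?case using lower[of k] lower[of "Suc k"] by (simp add: h_def)
  qed simp
  obtain n where n: "\<And>d. d \<ge> n \<Longrightarrow> f d = m * d" using assms by (auto simp: profile_def)
  have sub: "{d. i < h d} \<subseteq> {..<n}" for i using n by (fastforce simp: h_def not_le[symmetric])
  have fin: "finite {d. i < h d}" for i using sub finite_subset by blast
  have less_card: "d < card {d. i < h d} \<longleftrightarrow> i < h d" for d i
  proof -
    have "{d. i < h d} = {..<card {d. i < h d}}"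
    proof (rule downset_eq_lessThan[OF fin])
      fix x y assume "x \<in> {d. i < h d}" "y < x"
      then show "y \<in> {d. i < h d}" using anti[of y x] by simp
    qed
    then have "d \<in> {d. i < h d} \<longleftrightarrow> d \<in> {..<card {d. i < h d}}" by (rule arg_cong)
    then show ?thesis by simp
  qed
  \<comment> \<open>The conjugate of the column heights: each row gets one box for every column
    reaching it, and the first column counts the rows.\<close>
  define q where "q = map (\<lambda>i. card {d. i < h d}) [0..<h 0]"
  have "is_partition q"
    unfolding is_partition_def
  proof
    show "sorted_wrt (\<ge>) q"
      unfolding sorted_wrt_iff_nth_less
    proof (intro allI impI)
      fix i j assume ij: "i < j" "j < length q"
      have "card {d. j < h d} \<le> card {d. i < h d}" by (rule card_mono[OF fin]) (use ij in auto)
      then show "q ! j \<le> q ! i" using ij by (simp add: q_def)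
    qed
    show "0 \<notin> set q"
    proof
      assume "0 \<in> set q"
      then obtain i where "i < h 0" "card {d. i < h d} = 0" unfolding q_def by fastforce
      then show False using less_card[of 0 i] by simp
    qed
  qed
  moreover have "prof m q d = f d" for d
  proof -
    have "length (filter (\<lambda>x. d < x) q) = card {i. i < h 0 \<and> d < q ! i}"
      by (simp add: length_filter_conv_card q_def)
    also have "{i. i < h 0 \<and> d < q ! i} = {..<h d}"
    proof -
      have "i < h 0 \<and> d < q ! i \<longleftrightarrow> i < h d" for i
        using less_card[of d i] anti[of 0 d] by (cases "i < h 0") (auto simp: q_def)
      then show ?thesis by auto
    qed
    finally show ?thesis using lower[of d] by (simp add: prof_def h_def)
  qed
  ultimately show ?thesis by blast
qed

section \<open>Ladders and regularization\<close>

lemma ladder_eq: "y \<in> ladder l x \<Longrightarrow> ladder l y = ladder l x"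
  by (auto simp: ladder_def)

lemma ladder_refl: "x \<in> positions \<Longrightarrow> x \<in> ladder l x"
  by (auto simp: ladder_def positions_def)

lemma ladder_subset_positions: "ladder l x \<subseteq> positions"
  by (auto simp: ladder_def positions_def)

lemma ladder_pos:
  assumes "m = l - 1" "m * d < N"
  shows "ladder l (pos m N d) = pos m N ` {e. m * e < N}"
proof -
  have "x \<in> ladder l (pos m N d) \<longleftrightarrow> x \<in> pos m N ` {e. m * e < N}" for x
  proof (cases "snd x")
    case 0
    then show ?thesis by (cases x) (auto simp: ladder_def pos_def)
  next
    case (Suc e)
    have "x \<in> ladder l (pos m N d) \<longleftrightarrow> 1 \<le> fst x \<and> fst x + m * e = N"
      using assms Suc by (cases x) (auto simp: ladder_def pos_def)
    also have "\<dots> \<longleftrightarrow> m * e < N \<and> x = pos m N e"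
      using Suc by (cases x) (auto simp: pos_def)
    also have "\<dots> \<longleftrightarrow> x \<in> pos m N ` {e. m * e < N}"
      using Suc by (auto simp: pos_def)
    finally show ?thesis .
  qed
  then show ?thesis by blast
qed

lemma inj_pos: "inj_on (pos m N) A"
  by (auto simp: inj_on_def pos_def)

lemma card_ladder:
  assumes "m = l - 1" "m * d < N"
  shows "card (ladder l (pos m N d) \<inter> X) = card {e. m * e < N \<and> pos m N e \<in> X}"
proof -
  have "ladder l (pos m N d) \<inter> X = pos m N ` {e. m * e < N \<and> pos m N e \<in> X}"
    using ladder_pos[OF assms] by auto
  then show ?thesis by (simp add: card_image inj_pos)
qed

lemma finite_ladder:
  assumes "2 \<le> l"
  shows "finite (ladder l x)"
proof (cases "ladder l x = {}")
  case False
  then obtain y where "y \<in> ladder l x" by blast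
  then have "y \<in> positions" "ladder l x = ladder l y"
    using ladder_subset_positions ladder_eq by blast+
  moreover from \<open>y \<in> positions\<close> obtain N d where "(l - 1) * d < N" "y = pos (l - 1) N d"
    by (rule positions_cases)
  ultimately show ?thesis
    using ladder_pos[OF refl, of l d N] finite_below[of "l - 1" "\<lambda>d. (l - 1) * d" N] assms by simp
qed simp

text \<open>A term of the union depends only on the ladder of its index and stays inside that
  ladder, so each ladder sees just its own term.\<close>

lemma regularization_inter_ladder:
  assumes "x \<in> positions"
  shows "ladder l x \<inter> regularization l p = topmost (card (ladder l x \<inter> diagram p)) (ladder l x)"
    (is "_ = ?T x")
proof
  have sub: "?T y \<subseteq> ladder l y" for y by (auto simp: topmost_def)
  show "ladder l x \<inter> regularization l p \<subseteq> ?T x"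
  proof
    fix z assume z: "z \<in> ladder l x \<inter> regularization l p"
    then obtain y where y: "z \<in> ?T y" by (auto simp: regularization_def)
    then have "ladder l y = ladder l x" using z sub ladder_eq by blast
    then show "z \<in> ?T x" using y by simp
  qed
  show "?T x \<subseteq> ladder l x \<inter> regularization l p"
    using sub assms by (auto simp: regularization_def)
qed

lemma card_regularization:
  assumes "2 \<le> l" "x \<in> positions"
  shows "card (ladder l x \<inter> regularization l p) = card (ladder l x \<inter> diagram p)"
  unfolding regularization_inter_ladder[OF assms(2)] topmost_def
proof (rule card_first)
  show "inj_on fst (ladder l x)"
  proof (rule inj_onI)
    fix y z assume yz: "y \<in> ladder l x" "z \<in> ladder l x" "fst y = fst z"
    from yz(1,2) have "fst y + (l - 1) * snd y = fst z + (l - 1) * snd z" by (auto simp: ladder_def)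
    then have "(l - 1) * snd y = (l - 1) * snd z" using yz(3) by simp
    then have "snd y = snd z" using assms(1) by simp
    then show "y = z" using yz(3) by (simp add: prod_eq_iff)
  qed
qed (simp_all add: finite_ladder[OF assms(1)] card_mono)

lemma regularization_eq_iff:
  assumes "2 \<le> l"
  shows "regularization l p = regularization l q \<longleftrightarrow>
    (\<forall>x\<in>positions. card (ladder l x \<inter> diagram p) = card (ladder l x \<inter> diagram q))"
proof
  assume "regularization l p = regularization l q"
  then show "\<forall>x\<in>positions. card (ladder l x \<inter> diagram p) = card (ladder l x \<inter> diagram q)"
    using card_regularization[OF assms, symmetric] by simp
qed (simp add: regularization_def)

text \<open>The columns meeting ladder \<open>N\<close> split into boxes and gaps, which turns box
  counts into counts of small profile values. \<open>c = 0\<close> takes the whole ladder; general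
  \<open>c\<close> cuts off its upper end, as dominance requires.\<close>

lemma card_present:
  fixes f :: "nat \<Rightarrow> nat"
  assumes "0 < m" "\<And>d. m * d \<le> f d"
  shows "card {d. c \<le> d \<and> m * d < N \<and> N \<le> f d} + card {d. c \<le> d \<and> f d < N}
    = card {d. c \<le> d \<and> m * d < N}"
proof -
  have fin: "finite {d. m * d < N}" using finite_below[OF assms(1), of "\<lambda>d. m * d"] by simp
  have "{d. c \<le> d \<and> m * d < N} = {d. c \<le> d \<and> m * d < N \<and> N \<le> f d} \<union> {d. c \<le> d \<and> f d < N}"
    using le_less_trans[OF assms(2)] by auto
  moreover have "finite {d. c \<le> d \<and> m * d < N \<and> N \<le> f d}"
    by (rule finite_subset[OF _ fin]) auto
  moreover have "finite {d. c \<le> d \<and> f d < N}"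
    by (rule finite_subset[OF _ fin]) (use le_less_trans[OF assms(2)] in auto)
  moreover have "{d. c \<le> d \<and> m * d < N \<and> N \<le> f d} \<inter> {d. c \<le> d \<and> f d < N} = {}" by auto
  ultimately show ?thesis by (simp add: card_Un_disjoint)
qed

lemma regularization_eq_iff_prof:
  assumes "2 \<le> l" "m = l - 1" "is_partition p" "is_partition q"
  shows "regularization l p = regularization l q \<longleftrightarrow>
    (\<forall>N. card {d. prof m p d < N} = card {d. prof m q d < N})"
proof -
  have m: "0 < m" using assms by simp
  have count: "card (ladder l (pos m N d) \<inter> diagram r) + card {d. prof m r d < N} = card {d. m * d < N}"
    if "m * d < N" "is_partition r" for N d r
  proof -
    have "card (ladder l (pos m N d) \<inter> diagram r) = card {e. m * e < N \<and> N \<le> prof m r e}"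
      unfolding card_ladder[OF assms(2) that(1)]
      using pos_mem_diagram_iff[OF that(2)] by (metis (no_types, lifting))
    then show ?thesis using card_present[OF m, of "prof m r" 0 N] by (simp add: prof_def)
  qed
  show ?thesis
    unfolding regularization_eq_iff[OF assms(1)]
  proof
    assume L: "\<forall>x\<in>positions. card (ladder l x \<inter> diagram p) = card (ladder l x \<inter> diagram q)"
    show "\<forall>N. card {d. prof m p d < N} = card {d. prof m q d < N}"
    proof
      fix N
      show "card {d. prof m p d < N} = card {d. prof m q d < N}"
      proof (cases "N = 0")
        case False
        \<comment> \<open>Every nonempty ladder meets the first column, which serves as its
          representative.\<close>
        then have 0: "m * 0 < N" by simp
        show ?thesis using count[OF 0 assms(3)] count[OF 0 assms(4)] L pos_mem_positions[OF 0] by fastforce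
      qed simp
    qed
  next
    assume R: "\<forall>N. card {d. prof m p d < N} = card {d. prof m q d < N}"
    show "\<forall>x\<in>positions. card (ladder l x \<inter> diagram p) = card (ladder l x \<inter> diagram q)"
    proof
      fix x assume "x \<in> positions"
      then obtain N d where x: "m * d < N" "x = pos m N d" by (rule positions_cases)
      show "card (ladder l x \<inter> diagram p) = card (ladder l x \<inter> diagram q)"
        using count[OF x(1) assms(3)] count[OF x(1) assms(4)] R x(2) by (metis add_right_cancel)
    qed
  qed
qed

section \<open>Locked boxes in terms of profiles\<close>

lemma locked_subset_diagram: "locked l p \<subseteq> diagram p"
proof (rule subrelI)
  show "(a, b) \<in> diagram p" if "(a, b) \<in> locked l p" for a b
    using that by (induction rule: locked.induct) (auto simp: diagram_def)
qed

text \<open>Rule \<open>type_I\<close> demands the box above, and for \<open>type_II\<close> the box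
  above is obtained by moving left in the row above. With \<open>type_II\<close> this makes the
  locked boxes a Young diagram.\<close>

lemma locked_above:
  assumes "(a, b) \<in> locked l p" "1 \<le> a'" "a' \<le> a"
  shows "(a', b) \<in> locked l p"
proof -
  have up: "(a - 1, b) \<in> locked l p" if "(a, b) \<in> locked l p" "1 < a" for a b
    using that by (induction rule: locked.induct) (auto intro: locked.type_II)
  show ?thesis using assms(3,1)
  proof (induction rule: inc_induct)
    case (step k)
    then show ?case using up[of "Suc k" b] assms(2) by simp
  qed
qed

definition lprof :: "nat \<Rightarrow> nat list \<Rightarrow> nat \<Rightarrow> nat" where
  "lprof l p d = card {a. (a, Suc d) \<in> locked l p} + (l - 1) * d"

lemma mem_locked_iff:
  "(a, Suc d) \<in> locked l p \<longleftrightarrow> 1 \<le> a \<and> a + (l - 1) * d \<le> lprof l p d"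
proof -
  let ?A = "{i. (Suc i, Suc d) \<in> locked l p}"
  have pos: "1 \<le> a" if "(a, Suc d) \<in> locked l p" for a
    using that locked_subset_diagram[of l p] by (auto simp: diagram_def)
  have "?A \<subseteq> {..length p}" using locked_subset_diagram[of l p] by (auto simp: diagram_def)
  then have "finite ?A" by (rule finite_subset) simp
  then have A: "?A = {..<card ?A}" by (rule downset_eq_lessThan) (auto intro: locked_above)
  have "{a. (a, Suc d) \<in> locked l p} = Suc ` ?A"
  proof safe
    fix a assume a: "(a, Suc d) \<in> locked l p"
    then have "1 \<le> a" by (rule pos)
    then obtain i where "a = Suc i" by (cases a) auto
    then show "a \<in> Suc ` ?A" using a by blast
  qed
  then have card: "card {a. (a, Suc d) \<in> locked l p} = card ?A" by (simp add: card_image)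
  show ?thesis
  proof (cases a)
    case 0
    then show ?thesis using pos[of 0] by auto
  next
    case (Suc i)
    then have "(a, Suc d) \<in> locked l p \<longleftrightarrow> i \<in> ?A" by simp
    also have "\<dots> \<longleftrightarrow> i < card ?A" using A by blast
    finally show ?thesis using Suc card by (simp add: lprof_def Suc_le_eq)
  qed
qed

lemma pos_mem_locked_iff:
  assumes "m = l - 1" "m * d < N"
  shows "pos m N d \<in> locked l p \<longleftrightarrow> N \<le> lprof l p d"
  using mem_locked_iff[of "N - m * d" d l p] assms by (auto simp: pos_def)

text \<open>\<open>g_value\<close> records that the locked part of a column can stop early only
  where \<open>type_I\<close> is obstructed; \<open>g_min\<close> records that a locked box without
  a locked right neighbour must come from \<open>type_I\<close>.\<close>

lemma locked_profile_lprof: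
  assumes "2 \<le> l" "is_partition p" "m = l - 1"
  shows "locked_profile m (prof m p) (lprof l p)"
proof
  show "0 < m" using assms by simp
  show prof: "profile m (prof m p)" using assms(2) by (rule profile_prof)
  show lower: "m * d \<le> lprof l p d" for d by (simp add: lprof_def assms(3))
  show le: "lprof l p d \<le> prof m p d" for d
  proof (cases "m * d < lprof l p d")
    case True
    then show ?thesis
      using pos_mem_locked_iff[OF assms(3) True] pos_mem_diagram_iff[OF assms(2) True]
        locked_subset_diagram by blast
  qed (simp add: prof_def)
  show step: "lprof l p (Suc d) \<le> lprof l p d + m" for d
  proof (cases "m * Suc d < lprof l p (Suc d)")
    case True
    define a where "a = lprof l p (Suc d) - m * Suc d"
    have "(a, Suc (Suc d)) \<in> locked l p" using mem_locked_iff[of a "Suc d" l p] True assms(3) by (simp add: a_def)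
    then have "(a, Suc d) \<in> locked l p" by (rule locked.type_II) auto
    then have "a + m * d \<le> lprof l p d" using mem_locked_iff[of a d l p] assms(3) by blast
    moreover have "a + m * Suc d = lprof l p (Suc d)" using True by (simp add: a_def)
    ultimately show ?thesis by simp
  qed (use lower[of d] in simp)
  fix d
  show "\<exists>i\<le>d. lprof l p d = prof m p i"
  proof (cases "lprof l p d = prof m p d")
    case False
    \<comment> \<open>The first box of the column that is not locked. What blocks
      \<open>type_I\<close> is a column ending just above a lower position of its ladder, and that
      column has the desired profile value.\<close>
    define a where "a = Suc (lprof l p d) - m * d"
    have a: "1 \<le> a" "a + m * d = Suc (lprof l p d)" using lower[of d] by (auto simp: a_def)
    have "a + m * d \<le> prof m p d" using le[of d] False a by simp
    then have "(a, Suc d) \<in> diagram p" using mem_diagram_iff[OF assms(2)] a by blast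
    moreover have "a = 1 \<or> (a - 1, Suc d) \<in> locked l p"
      using mem_locked_iff[of "a - 1" d l p] a assms(3) by auto
    moreover have "(a, Suc d) \<notin> locked l p"
      using mem_locked_iff[of a d l p] a assms(3) by auto
    ultimately obtain c e where ce: "(c, e) \<in> ladder l (a, Suc d)" "(c, e) \<notin> diagram p"
      "a < c" "(c - 1, e) \<in> diagram p"
      using locked.type_I[of a "Suc d" p l] by auto
    then obtain i where i: "e = Suc i" by (cases e) (auto simp: ladder_def)
    have eq: "c + m * i = a + m * d" using ce i assms(3) by (auto simp: ladder_def)
    have "\<not> c + m * i \<le> prof m p i" using ce(2,3) i mem_diagram_iff[OF assms(2), of c i m] by auto
    moreover have "c - 1 + m * i \<le> prof m p i" using ce(4) i mem_diagram_iff[OF assms(2), of "c - 1" i m] by auto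
    ultimately have "prof m p i = lprof l p d" using eq a ce(3) by simp
    moreover have "i \<le> d"
    proof -
      have "m * i \<le> m * d" using eq ce(3) by linarith
      then show ?thesis using assms by simp
    qed
    ultimately show ?thesis by metis
  qed auto
  fix i assume i: "i \<le> d" and ge: "lprof l p (Suc d) \<le> prof m p i + m"
  show "lprof l p d \<le> prof m p i"
  proof (rule ccontr)
    assume n: "\<not> lprof l p d \<le> prof m p i"
    \<comment> \<open>Row \<open>a\<close> is where the ladder just after the end of column
      \<open>i + 1\<close> meets column \<open>d + 1\<close>. The box there is locked, its right
      neighbour is not, and row \<open>c\<close> is the gap ending column \<open>i + 1\<close> on
      that ladder.\<close>
    define a where "a = Suc (prof m p i) - m * d"
    have "m * d \<le> prof m p i" using ge lower[of "Suc d"] by simp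
    then have a: "1 \<le> a" "a + m * d = Suc (prof m p i)" by (auto simp: a_def)
    have lock: "(a, Suc d) \<in> locked l p" using mem_locked_iff[of a d l p] a n assms(3) by simp
    have nlock: "(a, Suc (Suc d)) \<notin> locked l p" using mem_locked_iff[of a "Suc d" l p] a ge assms(3) by simp
    have "i \<noteq> d" using n le[of d] by auto
    with i have id: "i < d" by simp
    define c where "c = Suc (prof m p i) - m * i"
    have c: "c + m * i = Suc (prof m p i)" by (simp add: c_def prof_def)
    have "a < c"
    proof -
      have "m * i < m * d" using id assms by simp
      then show ?thesis using a c by linarith
    qed
    have "(c, Suc i) \<in> ladder l (a, Suc d)" using a c assms(3) \<open>a < c\<close> by (simp add: ladder_def)
    moreover have "(c, Suc i) \<notin> diagram p" using mem_diagram_iff[OF assms(2), of c i m] c by simp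
    moreover have "(c - 1, Suc i) \<in> diagram p"
      using mem_diagram_iff[OF assms(2), of "c - 1" i m] c a \<open>a < c\<close> by simp
    \<comment> \<open>Had the box been locked through \<open>type_II\<close>, its right neighbour
      would be locked too; so the ladder condition of \<open>type_I\<close> holds and forbids the
      gap.\<close>
    moreover have "\<forall>(c, e) \<in> ladder l (a, Suc d). (c, e) \<notin> diagram p \<and> c > a \<longrightarrow> (c - 1, e) \<notin> diagram p"
      using lock
    proof cases
      case (type_II b)
      then have "(a, Suc (Suc d)) \<in> locked l p"
        by (cases "b = Suc (Suc d)") (auto intro: locked.type_II)
      then show ?thesis using nlock by simp
    qed
    ultimately show False using \<open>a < c\<close> by blast
  qed
qed

text \<open>If all boxes are locked, the two profiles coincide and \<open>tight_g\<close> applies;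
  the converse is \<open>tight_imp_eq\<close>.\<close>

lemma all_locked_iff_tight:
  assumes "2 \<le> l" "is_partition p" "m = l - 1"
  shows "(\<forall>x\<in>diagram p. x \<in> locked l p) \<longleftrightarrow> tight m (prof m p)"
proof -
  interpret locked_profile m "prof m p" "lprof l p" using locked_profile_lprof[OF assms] .
  show ?thesis
  proof
    assume L: "\<forall>x\<in>diagram p. x \<in> locked l p"
    have "lprof l p d = prof m p d" for d
    proof (cases "m * d < prof m p d")
      case True
      then show ?thesis
        using L pos_mem_diagram_iff[OF assms(2) True] pos_mem_locked_iff[OF assms(3) True] g_le[of d] by auto
    qed (use g_le[of d] g_lower[of d] in simp)
    then have "lprof l p = prof m p" ..
    then show "tight m (prof m p)" using tight_g by simp
  next
    assume T: "tight m (prof m p)"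
    show "\<forall>x\<in>diagram p. x \<in> locked l p"
    proof
      fix x assume x: "x \<in> diagram p"
      then have "x \<in> positions" by (auto simp: diagram_def positions_def)
      then obtain N d where "m * d < N" "x = pos m N d" by (rule positions_cases)
      then show "x \<in> locked l p"
        using x pos_mem_diagram_iff[OF assms(2)] pos_mem_locked_iff[OF assms(3)] tight_imp_eq[OF T] by metis
    qed
  qed
qed

section \<open>Deregularization as sliding of profiles\<close>

lemma mem_deregularization_iff:
  assumes "x \<in> positions"
  shows "x \<in> deregularization l p \<longleftrightarrow>
    x \<in> locked l p \<or> x \<in> lowest (card (ladder l x \<inter> unlocked l p)) (ladder l x - locked l p)"
    (is "_ \<longleftrightarrow> _ \<or> x \<in> ?S x")
proof -
  have "x \<in> ?S x" if "x \<in> ?S y" for y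
  proof -
    have "x \<in> ladder l y" using that by (auto simp: lowest_def)
    then show ?thesis using that ladder_eq by metis
  qed
  then show ?thesis using assms by (auto simp: deregularization_def)
qed

lemma deregularization_subset: "deregularization l p \<subseteq> positions"
proof
  fix x assume "x \<in> deregularization l p"
  then consider "x \<in> locked l p" | y where "x \<in> ladder l y"
    by (auto simp: deregularization_def lowest_def)
  then show "x \<in> positions"
  proof cases
    case 1
    then have "x \<in> diagram p" using locked_subset_diagram by blast
    then show ?thesis by (auto simp: diagram_def positions_def)
  next
    case 2
    then show ?thesis using ladder_subset_positions by blast
  qed
qed

text \<open>Lower on a ladder means further left, so the free positions below a position are the
  columns \<open>e < d\<close> with \<open>lprof l p e < N\<close>. Comparing their number with that
  of the unlocked boxes is the criterion of \<open>occ_iff_card\<close>.\<close>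

lemma pos_mem_deregularization_iff:
  assumes "2 \<le> l" "is_partition p" "m = l - 1" "m * d < N"
  shows "pos m N d \<in> deregularization l p \<longleftrightarrow> N \<le> locked_profile.slid (prof m p) (lprof l p) d"
proof -
  interpret locked_profile m "prof m p" "lprof l p" using locked_profile_lprof[OF assms(1-3)] .
  let ?x = "pos m N d"
  note lock = pos_mem_locked_iff[OF assms(3), of _ N p]
  show ?thesis
  proof (cases "N \<le> lprof l p d")
    case True
    then show ?thesis using lock[OF assms(4)] g_le_slid[of d] by (auto simp: deregularization_def)
  next
    case False
    have "card (ladder l ?x \<inter> unlocked l p) = card {e. lprof l p e < N \<and> N \<le> prof m p e}"
      unfolding card_ladder[OF assms(3,4)]
    proof (rule arg_cong[of _ _ card], safe)
      fix e assume "m * e < N" "pos m N e \<in> unlocked l p"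
      then show "lprof l p e < N" "N \<le> prof m p e"
        using lock pos_mem_diagram_iff[OF assms(2), of m e N] by (auto simp: unlocked_def)
    next
      fix e assume e: "lprof l p e < N" "N \<le> prof m p e"
      then show "m * e < N" using g_lower[of e] by simp
      then show "pos m N e \<in> unlocked l p"
        using e lock pos_mem_diagram_iff[OF assms(2), of m e N] by (auto simp: unlocked_def)
    qed
    moreover have "card {y \<in> ladder l ?x - locked l p. fst y > fst ?x} = card {e. e < d \<and> lprof l p e < N}"
    proof -
      have "{y \<in> ladder l ?x - locked l p. fst y > fst ?x} = ladder l ?x \<inter> {y. y \<notin> locked l p \<and> fst y > fst ?x}"
        by auto
      moreover have "m * e < N \<and> pos m N e \<notin> locked l p \<and> fst (pos m N e) > fst ?x
          \<longleftrightarrow> e < d \<and> lprof l p e < N" for e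
      proof (cases "m * e < N")
        case True
        have "N - m * e > N - m * d \<longleftrightarrow> m * e < m * d"
          using True assms(4) by (intro iffI) linarith+
        also have "\<dots> \<longleftrightarrow> e < d" using m by simp
        finally show ?thesis using True lock[OF True] by (auto simp: pos_def)
      next
        case F: False
        then show ?thesis using g_lower[of e] by auto
      qed
      ultimately show ?thesis by (simp add: card_ladder[OF assms(3,4)])
    qed
    moreover have "?x \<in> ladder l ?x" using ladder_refl pos_mem_positions assms(4) by blast
    ultimately show ?thesis
      using False lock[OF assms(4)] occ_iff_card[of d N] occ_iff[of d N]
        mem_deregularization_iff[OF pos_mem_positions[OF assms(4)], of l p]
      by (simp add: lowest_def)
  qed
qed

section \<open>Dominance order, computed ladder by ladder\<close>

lemma sum_list_take_eq_card:
  "sum_list (take i p) = card {x \<in> diagram p. fst x \<le> i}"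
proof -
  have "{x \<in> diagram p. fst x \<le> i} = (SIGMA a:{Suc 0..<Suc (length (take i p))}. {1..p ! (a - 1)})"
    by (auto simp: diagram_def)
  then have "card {x \<in> diagram p. fst x \<le> i} = (\<Sum>a = Suc 0..<Suc (length (take i p)). p ! (a - 1))"
    by simp
  also have "\<dots> = (\<Sum>a = 0..<length (take i p). p ! a)"
    by (subst sum.shift_bounds_Suc_ivl) simp
  also have "\<dots> = sum_list (take i p)" by (simp add: sum_list_sum_nth)
  finally show ?thesis by simp
qed

lemma sum_list_take_eq_ladders:
  assumes "0 < m" "is_partition p"
  shows "\<exists>B0. \<forall>B\<ge>B0. \<forall>i. sum_list (take i p) =
    (\<Sum>N\<le>B. card {d. m * d < N \<and> N \<le> prof m p d \<and> N \<le> i + m * d})"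
proof -
  obtain n where n: "\<And>d. d \<ge> n \<Longrightarrow> prof m p d = m * d"
    using profile_prof[OF assms(2), of m] by (auto simp: profile_def)
  \<comment> \<open>The bound exceeds every profile value of a nonempty column, so all boxes lie on
    ladders up to \<open>B\<close>. It does not depend on \<open>i\<close>, so two partitions can
    share one range.\<close>
  have "sum_list (take i p) = (\<Sum>N\<le>B. card {d. m * d < N \<and> N \<le> prof m p d \<and> N \<le> i + m * d})"
    if B: "(\<Sum>e<n. prof m p e) \<le> B" for B i
  proof -
    let ?D = "\<lambda>N. {d. m * d < N \<and> N \<le> prof m p d \<and> N \<le> i + m * d}"
    have fin: "finite (?D N)" for N
      by (rule finite_subset[OF _ finite_below[OF assms(1), of "\<lambda>d. m * d" N]]) auto
    have "{x \<in> diagram p. fst x \<le> i} = (\<lambda>(N, d). pos m N d) ` (SIGMA N:{..B}. ?D N)"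
    proof (intro set_eqI iffI)
      fix x assume x: "x \<in> {x \<in> diagram p. fst x \<le> i}"
      then have "x \<in> positions" by (auto simp: diagram_def positions_def)
      then obtain N d where Nd: "m * d < N" "x = pos m N d" by (rule positions_cases)
      then have le: "N \<le> prof m p d" using x pos_mem_diagram_iff[OF assms(2) Nd(1)] by simp
      then have "d < n" using n[of d] Nd by (cases "d < n") auto
      then have "prof m p d \<le> (\<Sum>e<n. prof m p e)" by (intro member_le_sum) auto
      with le B have "N \<le> B" by simp
      moreover have "N \<le> i + m * d" using x Nd by (auto simp: pos_def)
      ultimately show "x \<in> (\<lambda>(N, d). pos m N d) ` (SIGMA N:{..B}. ?D N)"
        using Nd le by (intro image_eqI[of _ _ "(N, d)"]) auto
    next
      fix x assume "x \<in> (\<lambda>(N, d). pos m N d) ` (SIGMA N:{..B}. ?D N)"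
      then obtain N d where Nd: "m * d < N" "N \<le> prof m p d" "N \<le> i + m * d" "x = pos m N d" by auto
      then have "x \<in> diagram p" using pos_mem_diagram_iff[OF assms(2)] by simp
      moreover have "fst x \<le> i" using Nd by (auto simp: pos_def)
      ultimately show "x \<in> {x \<in> diagram p. fst x \<le> i}" by simp
    qed
    moreover have "inj_on (\<lambda>(N, d). pos m N d) (SIGMA N:{..B}. ?D N)"
      by (auto simp: inj_on_def pos_def)
    ultimately show ?thesis using fin by (simp add: sum_list_take_eq_card card_image)
  qed
  then show ?thesis by blast
qed

text \<open>On each ladder the first \<open>i\<close> rows cut off an upper end, the columns from
  some \<open>c\<close> on. By \<open>card_present\<close>, more gaps of \<open>p\<close> there mean
  fewer boxes, and summing over ladders compares the partial sums.\<close>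

lemma dominance_leI:
  assumes m: "0 < m" and p: "is_partition p" and q: "is_partition q"
    and eq: "\<And>N. card {d. prof m p d < N} = card {d. prof m q d < N}"
    and le: "\<And>c N. card {d. c \<le> d \<and> prof m q d < N} \<le> card {d. c \<le> d \<and> prof m p d < N}"
  shows "dominance_le p q"
proof -
  obtain B1 where B1: "\<forall>B\<ge>B1. \<forall>i. sum_list (take i p) =
      (\<Sum>N\<le>B. card {d. m * d < N \<and> N \<le> prof m p d \<and> N \<le> i + m * d})"
    using sum_list_take_eq_ladders[OF m p] by blast
  obtain B2 where B2: "\<forall>B\<ge>B2. \<forall>i. sum_list (take i q) =
      (\<Sum>N\<le>B. card {d. m * d < N \<and> N \<le> prof m q d \<and> N \<le> i + m * d})"
    using sum_list_take_eq_ladders[OF m q] by blast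
  define B where "B = max B1 B2"
  have sums: "sum_list (take i p) =
      (\<Sum>N\<le>B. card {d. m * d < N \<and> N \<le> prof m p d \<and> N \<le> i + m * d})"
    "sum_list (take i q) =
      (\<Sum>N\<le>B. card {d. m * d < N \<and> N \<le> prof m q d \<and> N \<le> i + m * d})" for i
    using B1[rule_format, of B i] B2[rule_format, of B i] by (simp_all add: B_def)
  have present: "card {d. c \<le> d \<and> m * d < N \<and> N \<le> prof m r d} + card {d. c \<le> d \<and> prof m r d < N}
    = card {d. c \<le> d \<and> m * d < N}" for r c N
    by (rule card_present[OF m]) (simp add: prof_def)
  have "sum_list (take i p) \<le> sum_list (take i q)" for i
    unfolding sums
  proof (rule sum_mono)
    fix N
    \<comment> \<open>The first column in which ladder \<open>N\<close> has come up to row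
      \<open>i\<close> or above.\<close>
    define c where "c = (LEAST d. N \<le> i + m * d)"
    have "N \<le> i + m * N" using m by (cases m) auto
    then have c: "N \<le> i + m * c" unfolding c_def by (rule LeastI)
    have iff: "N \<le> i + m * d \<longleftrightarrow> c \<le> d" for d
    proof
      assume "c \<le> d"
      then have "m * c \<le> m * d" by simp
      then show "N \<le> i + m * d" using c by linarith
    qed (simp add: c_def Least_le)
    have "{d. m * d < N \<and> N \<le> prof m r d \<and> N \<le> i + m * d} = {d. c \<le> d \<and> m * d < N \<and> N \<le> prof m r d}" for r
      using iff by auto
    then show "card {d. m * d < N \<and> N \<le> prof m p d \<and> N \<le> i + m * d}
      \<le> card {d. m * d < N \<and> N \<le> prof m q d \<and> N \<le> i + m * d}"
      using present[of c N p] present[of c N q] le[of c N] by simp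
  qed
  moreover have "sum_list p = sum_list q"
  proof -
    \<comment> \<open>This takes in all rows of both partitions, and \<open>B \<le> i\<close> makes
      the row condition hold on every ladder of the sum.\<close>
    define i where "i = B + length p + length q"
    have "sum_list (take i p) = sum_list (take i q)"
      unfolding sums
    proof (rule sum.cong)
      fix N assume "N \<in> {..B}"
      then have "{d. m * d < N \<and> N \<le> prof m r d \<and> N \<le> i + m * d} = {d. 0 \<le> d \<and> m * d < N \<and> N \<le> prof m r d}" for r
        by (auto simp: i_def)
      then show "card {d. m * d < N \<and> N \<le> prof m p d \<and> N \<le> i + m * d}
        = card {d. m * d < N \<and> N \<le> prof m q d \<and> N \<le> i + m * d}"
        using present[of 0 N p] present[of 0 N q] eq[of N] by simp
    qed simp
    then show ?thesis by (simp add: i_def)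
  qed
  ultimately show ?thesis by (simp add: dominance_le_def)
qed

lemma dominance_le_antisym:
  assumes "is_partition p" "is_partition q" "dominance_le p q" "dominance_le q p"
  shows "p = q"
proof -
  have "\<forall>i. sum_list (take i p) = sum_list (take i q)"
    using assms by (auto simp: dominance_le_def intro: antisym)
  \<comment> \<open>Positive parts make the first partial sum of a nonempty list positive, which
    separates lists of different lengths.\<close>
  moreover have "0 \<notin> set p" "0 \<notin> set q" using assms by (auto simp: is_partition_def)
  ultimately show ?thesis
  proof (induction p arbitrary: q)
    case Nil
    then show ?case by (cases q) (auto dest: spec[of _ 1])
  next
    case (Cons x p)
    show ?case
    proof (cases q)
      case Nil
      then show ?thesis using Cons.prems by (auto dest: spec[of _ 1])
    next
      case q: (Cons y q')
      have "x = y" using Cons.prems(1) q by (auto dest: spec[of _ 1])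
      moreover have "sum_list (take i p) = sum_list (take i q')" for i
        using Cons.prems(1)[rule_format, of "Suc i"] q \<open>x = y\<close> by simp
      ultimately show ?thesis using Cons.IH[of q'] Cons.prems q by simp
    qed
  qed
qed

section \<open>Assembly of the result\<close>

lemma deregularization_partition:
  assumes "2 \<le> l" "is_partition p" "m = l - 1"
  obtains \<sigma> where "is_partition \<sigma>" "diagram \<sigma> = deregularization l p" "\<sigma> \<in> reg_class l p"
    "tight m (prof m \<sigma>)" "dominance_le \<sigma> p"
proof -
  interpret locked_profile m "prof m p" "lprof l p" using locked_profile_lprof[OF assms] .
  obtain \<sigma> where \<sigma>: "is_partition \<sigma>" "prof m \<sigma> = slid" using profile_ex[OF profile_slid] by blast
  have "x \<in> diagram \<sigma> \<longleftrightarrow> x \<in> deregularization l p" if x: "x \<in> positions" for x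
  proof -
    obtain N d where "m * d < N" "x = pos m N d" using x by (rule positions_cases)
    then show ?thesis using pos_mem_deregularization_iff[OF assms] pos_mem_diagram_iff[OF \<sigma>(1)] \<sigma>(2) by simp
  qed
  moreover have "diagram \<sigma> \<subseteq> positions" by (auto simp: diagram_def positions_def)
  ultimately have 1: "diagram \<sigma> = deregularization l p" using deregularization_subset[of l p] by blast
  have 2: "\<sigma> \<in> reg_class l p"
    using regularization_eq_iff_prof[OF assms(1,3) \<sigma>(1) assms(2)] card_slid \<sigma> by (simp add: reg_class_def)
  have 3: "dominance_le \<sigma> p"
    by (rule dominance_leI[OF m \<sigma>(1) assms(2)]) (use \<sigma>(2) card_slid card_slid_from in auto)
  show ?thesis using that[OF \<sigma>(1) 1 2 _ 3] \<sigma>(2) tight_slid by simp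
qed

theorem theorem7p13:
  fixes l :: nat and p :: "nat list"
  assumes "l \<ge> 3" and "is_partition p"
  shows "\<exists>\<sigma>. is_partition \<sigma> \<and> diagram \<sigma> = deregularization l p \<and>
           {\<mu> \<in> reg_class l p. \<forall>\<nu> \<in> reg_class l p. dominance_le \<mu> \<nu>} = {\<sigma>} \<and>
           {\<mu> \<in> reg_class l p. \<forall>x \<in> diagram \<mu>. x \<in> locked l \<mu>} = {\<sigma>}"
proof -
  define m where "m = l - 1"
  have l: "2 \<le> l" and m: "0 < m" using assms(1) by (auto simp: m_def)
  obtain \<sigma> where \<sigma>: "is_partition \<sigma>" "diagram \<sigma> = deregularization l p" "\<sigma> \<in> reg_class l p"
    "tight m (prof m \<sigma>)" using deregularization_partition[OF l assms(2) m_def] by blast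
  have part: "is_partition \<mu>" if "\<mu> \<in> reg_class l p" for \<mu> using that by (simp add: reg_class_def)
  have unique: "\<mu> = \<sigma>" if \<mu>: "\<mu> \<in> reg_class l p" "tight m (prof m \<mu>)" for \<mu>
  proof -
    have "regularization l \<mu> = regularization l \<sigma>" using \<mu> \<sigma> by (simp add: reg_class_def)
    then have "prof m \<mu> = prof m \<sigma>"
      using regularization_eq_iff_prof[OF l m_def part[OF \<mu>(1)] \<sigma>(1)] \<mu> \<sigma> part
      by (intro tight_unique[OF m] profile_prof) auto
    then show ?thesis using prof_inject \<sigma>(1) part[OF \<mu>(1)] by blast
  qed
  have least: "dominance_le \<sigma> \<nu>" if \<nu>: "\<nu> \<in> reg_class l p" for \<nu>
  proof -
    \<comment> \<open>Sliding \<open>\<nu>\<close> itself gives a tight member of the same class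
      below \<open>\<nu>\<close>; by uniqueness it is \<open>\<sigma>\<close>.\<close>
    obtain \<tau> where \<tau>: "\<tau> \<in> reg_class l \<nu>" "tight m (prof m \<tau>)" "dominance_le \<tau> \<nu>"
      using deregularization_partition[OF l part[OF \<nu>] m_def] by blast
    have "\<tau> \<in> reg_class l p" using \<tau>(1) \<nu> by (simp add: reg_class_def)
    then show ?thesis using unique \<tau> by blast
  qed
  have "{\<mu> \<in> reg_class l p. \<forall>\<nu> \<in> reg_class l p. dominance_le \<mu> \<nu>} = {\<sigma>}"
  proof safe
    fix \<mu> assume "\<mu> \<in> reg_class l p" "\<forall>\<nu> \<in> reg_class l p. dominance_le \<mu> \<nu>"
    then show "\<mu> = \<sigma>" using dominance_le_antisym[of \<mu> \<sigma>] least \<sigma>(1,3) part by simp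
  qed (use \<sigma>(3) least in auto)
  moreover have "{\<mu> \<in> reg_class l p. \<forall>x \<in> diagram \<mu>. x \<in> locked l \<mu>} = {\<sigma>}"
    using all_locked_iff_tight[OF l part m_def] unique \<sigma>(3,4) by blast
  ultimately show ?thesis using \<sigma>(1,2) by blast
qed

end
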